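(* Let $a$ be a positive integer. Then: (1) $T(a,a;2) \geq a^{2} + 3a + 8$ for $a \geq 4$; (2) $T(a,a;3) \geq 3a^{3} + 4a^{2} + 5a + 8$ for $a > 1$; (3) $T(a,a;4) \geq 7a^{4} + 12a^{3} + 6a^{2} + 9a + 16$ for $a > 1$.
   Context: For positive integers $a \leq b$, an $(a,b)$-triple is a triple of the form $(x, ax+d, bx+2d)$, where $x$ and $d$ are positive integers. For a positive integer $r$, $T(a,b;r)$ denotes the least positive integer $n$ such that every $r$-coloring of $[1,n]=\{1,2,\ldots,n\}$ contains a monochromatic $(a,b)$-triple (that is, an $(a,b)$-triple all of whose terms lie in $[1,n]$ and have the same color); if no such $n$ exists, $T(a,b;r)=\infty$, and any lower bound on it is regarded as true. *)

theory Defs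
  imports Main "HOL-Library.Extended_Nat"
begin

(* The conventions 0 < a \<le> b and 0 < r are left to the users of these definitions. *)

definition is_triple :: "nat \<Rightarrow> nat \<Rightarrow> nat \<times> nat \<times> nat \<Rightarrow> bool" where
  "is_triple a b t \<longleftrightarrow> (\<exists>x d. x > 0 \<and> d > 0 \<and> t = (x, a * x + d, b * x + 2 * d))"

(* The colors are 0, ..., r - 1; a coloring need not use all of them.
   Values of \<chi> outside {1..n} are irrelevant. *)
definition coloring :: "nat \<Rightarrow> nat \<Rightarrow> (nat \<Rightarrow> nat) \<Rightarrow> bool" where
  "coloring r n \<chi> \<longleftrightarrow> \<chi> ` {1..n} \<subseteq> {..<r}"

definition has_mono_triple :: "nat \<Rightarrow> nat \<Rightarrow> nat \<Rightarrow> (nat \<Rightarrow> nat) \<Rightarrow> bool" where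
  "has_mono_triple a b n \<chi> \<longleftrightarrow>
     (\<exists>u v w. is_triple a b (u, v, w) \<and> {u, v, w} \<subseteq> {1..n} \<and> \<chi> u = \<chi> v \<and> \<chi> v = \<chi> w)"

definition forces_triple :: "nat \<Rightarrow> nat \<Rightarrow> nat \<Rightarrow> nat \<Rightarrow> bool" where
  "forces_triple a b r n \<longleftrightarrow> (\<forall>\<chi>. coloring r n \<chi> \<longrightarrow> has_mono_triple a b n \<chi>)"

definition T :: "nat \<Rightarrow> nat \<Rightarrow> nat \<Rightarrow> enat" where
  "T a b r =
     (if \<exists>n>0. forces_triple a b r n
      then enat (LEAST n. n > 0 \<and> forces_triple a b r n) else \<infinity>)"

end

theory Submission
  imports Defs
begin

text \<open>
  Each bound \<open>T(a,a;r) \<ge> N\<close> comes from an \<open>r\<close>-coloring of \<open>[1, N - 1]\<close> without a monochromatic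
  triple, given by its color classes (\<open>T_ge_of_cover\<close>).

  A triple whose first entry is at least \<open>s\<close> ends at \<open>a * s + 2\<close> or later, so the interval
  \<open>[s, a * s + 1]\<close> can be given a single color. Starting at \<open>1\<close> and using a new color for each
  maximal interval of this kind, \<open>r\<close> colors reach up to the starting point \<open>s\<^sub>r\<close> of a would-be
  next interval. After that the colors are used a second time, in the same order, except for the
  last one. A triple of color \<open>j\<close> that ends in the second interval \<open>[p, q)\<close> of that color must have
  its middle entry \<open>y \<ge> p\<close> as well, because a first and a middle entry in the first interval
  force the last one to lie just behind that interval; its first entry \<open>x\<close> is still in the first interval, so
  \<open>x \<le> a * s\<^sub>j + 1\<close>. As the last entry is \<open>2 * y - a * x\<close>, color \<open>j\<close> is safe as long as
  \<open>q \<le> 2 * p - a * (a * s\<^sub>j + 1)\<close> (\<open>triple_free_two_blocks\<close>). Taking equality throughout gives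
  \<open>T_ge_second_start\<close>, which is valid for all \<open>a \<ge> 2\<close> and \<open>r > 0\<close> and specializes to the claims for
  three and four colors.

  For two colors this scheme stops at \<open>a\<^sup>2 + 3 * a + 3\<close>. The four numbers that follow can get
  the color of the middle interval \<open>[a + 2, a\<^sup>2 + 2 * a + 1]\<close>: a triple with its last two entries
  among them starts with some \<open>x\<close> such that \<open>a * x\<close> is smaller than the middle entry, which leaves
  only \<open>x \<le> a + 4\<close>. The values \<open>x \<le> a + 3\<close> send the last entry to \<open>a\<^sup>2 + 3 * a + 8\<close> or
  beyond, and the only dangerous value \<open>a + 4\<close> is given the other color.
\<close>

section \<open>Lower bounds from triple-free color classes\<close>

definition triple_free :: "nat \<Rightarrow> nat \<Rightarrow> nat set \<Rightarrow> bool" where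
  "triple_free a b A \<longleftrightarrow>
     (\<forall>x d. x > 0 \<longrightarrow> d > 0 \<longrightarrow> x \<in> A \<longrightarrow> a * x + d \<in> A \<longrightarrow> b * x + 2 * d \<notin> A)"

text \<open>The classes may overlap: a number that lies in several of them takes the color of any one.\<close>

lemma T_ge_of_cover:
  assumes cover: "{1..<N} \<subseteq> (\<Union>i<r. A i)"
    and free: "\<And>i. i < r \<Longrightarrow> triple_free a b (A i)"
  shows "T a b r \<ge> enat N"
proof -
  have "\<forall>m\<in>{1..<N}. \<exists>i<r. m \<in> A i" using cover by blast
  then obtain \<chi> where \<chi>: "\<And>m. m \<in> {1..<N} \<Longrightarrow> \<chi> m < r \<and> m \<in> A (\<chi> m)"
    by metis
  have large: "N \<le> n" if "forces_triple a b r n" for n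
  proof (rule ccontr)
    assume "\<not> N \<le> n"
    then have sub: "{1..n} \<subseteq> {1..<N}" by auto
    then have "coloring r n \<chi>" using \<chi> unfolding coloring_def by blast
    then have "has_mono_triple a b n \<chi>" using that unfolding forces_triple_def by blast
    then obtain x d where pos: "x > 0" "d > 0"
      and range: "{x, a * x + d, b * x + 2 * d} \<subseteq> {1..n}"
      and mono: "\<chi> x = \<chi> (a * x + d)" "\<chi> (a * x + d) = \<chi> (b * x + 2 * d)"
      unfolding has_mono_triple_def is_triple_def by blast
    have "x \<in> A (\<chi> x)" "a * x + d \<in> A (\<chi> x)" "b * x + 2 * d \<in> A (\<chi> x)" "\<chi> x < r"
      using \<chi> range mono sub by (metis insert_subset subsetD)+
    then show False using free pos unfolding triple_free_def by blast
  qed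
  show ?thesis
  proof (cases "\<exists>n>0. forces_triple a b r n")
    case True
    then have "forces_triple a b r (LEAST n. n > 0 \<and> forces_triple a b r n)"
      by (metis (mono_tags, lifting) LeastI_ex)
    with True large show ?thesis by (simp add: T_def)
  next
    case False
    then have "T a b r = \<infinity>" unfolding T_def by (rule if_not_P)
    then show ?thesis by simp
  qed
qed

section \<open>Color classes made of two intervals\<close>

text \<open>
  The only possible first and middle entries inside \<open>[s, a * s + 1]\<close> are \<open>s\<close> and \<open>a * s + 1\<close>,
  which are completed by \<open>a * s + 2\<close>; hence the gap before \<open>p\<close>. Otherwise the middle entry is at least \<open>p\<close>, and the
  last one is smallest when the first entry is as large as possible. The parameter \<open>e\<close> bounds the
  first entries that have to be considered: beyond \<open>e\<close>, a triple leaves \<open>[1, q)\<close> anyway.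
\<close>

lemma triple_free_two_blocks:
  assumes "a > 0" and A: "A \<subseteq> {s..a * s + 1} \<union> {p..<q}" and gap: "a * s + 2 < p"
    and near: "q + a * e \<le> 2 * p"
    and far: "\<And>x. x \<in> A \<Longrightarrow> e < x \<Longrightarrow> q \<le> a * x + 2"
  shows "triple_free a a A"
  unfolding triple_free_def
proof (intro allI impI notI)
  fix x d assume "d > 0" and x: "x \<in> A" and y: "a * x + d \<in> A" and z: "a * x + 2 * d \<in> A"
  have "s \<le> a * s" using \<open>a > 0\<close> by simp
  moreover have "s \<le> x \<or> p \<le> x" using x A by auto
  ultimately have "s \<le> x" using gap by linarith
  then have ax: "a * s \<le> a * x" by simp
  have "a * x + 2 * d \<le> a * s + 1 \<or> p \<le> a * x + 2 * d \<and> a * x + 2 * d < q" using z A by auto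
  then have zq: "p \<le> a * x + 2 * d" "a * x + 2 * d < q" using ax \<open>d > 0\<close> by linarith+
  have "x \<le> e" using far[OF x] zq \<open>d > 0\<close> by linarith
  then have "a * x \<le> a * e" by simp
  then have "a * x + d < p" using near zq by linarith
  then have "a * x + d \<le> a * s + 1" using y A by force
  then show False using ax zq gap \<open>d > 0\<close> by linarith
qed

lemma triple_free_block: "triple_free a a {s..<a * s + 2}"
  unfolding triple_free_def
proof (intro allI impI notI)
  fix x d :: nat assume "d > 0" and x: "x \<in> {s..<a * s + 2}" and z: "a * x + 2 * d \<in> {s..<a * s + 2}"
  have "a * s \<le> a * x" using x by (intro mult_le_mono2) simp
  then show False using z \<open>d > 0\<close> unfolding atLeastLessThan_iff by linarith
qed

section \<open>Using all but the last color twice\<close>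

fun start :: "nat \<Rightarrow> nat \<Rightarrow> nat" where
  "start a 0 = 1"
| "start a (Suc i) = a * start a i + 2"

text \<open>
  The subtraction is not truncated as long as \<open>j + 2 \<le> r\<close>, that is, for every color but the last
  (\<open>second_start_Suc\<close>).
\<close>

fun second_start :: "nat \<Rightarrow> nat \<Rightarrow> nat \<Rightarrow> nat" where
  "second_start a r 0 = start a r"
| "second_start a r (Suc j) = 2 * second_start a r j - a * (a * start a j + 1)"

lemma start_less_Suc: "a > 0 \<Longrightarrow> start a i < start a (Suc i)"
  by (cases a) (auto simp: less_Suc_eq_le)

lemma start_mono: "a > 0 \<Longrightarrow> i \<le> j \<Longrightarrow> start a i \<le> start a j"
  by (rule lift_Suc_mono_le[of "start a"]) (auto simp del: start.simps intro: less_imp_le start_less_Suc)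

text \<open>
  Here \<open>a * (a * start a j + 1)\<close> is smaller than \<open>start a (j + 2)\<close>, and this is at most
  \<open>start a r\<close>, where the second round begins.
\<close>

lemma second_start_ge:
  assumes "a > 0" "j < r"
  shows "start a r \<le> second_start a r j"
  using assms(2)
proof (induction j)
  case (Suc j)
  then have "start a (Suc (Suc j)) \<le> start a r" by (intro start_mono assms(1)) simp
  then show ?case using Suc by (simp add: algebra_simps)
qed simp

lemma second_start_Suc:
  assumes "a > 0" "Suc j < r"
  shows "second_start a r (Suc j) + a * (a * start a j + 1) = 2 * second_start a r j"
proof -
  have "start a (Suc (Suc j)) \<le> start a r" using assms by (intro start_mono) simp_all
  then show ?thesis using second_start_ge[of a j r] assms by (simp add: algebra_simps)
qed

lemma ex_step_containing:
  fixes f :: "nat \<Rightarrow> nat"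
  assumes "f 0 \<le> m" "m < f k"
  shows "\<exists>i<k. f i \<le> m \<and> m < f (Suc i)"
  using assms by (induction k) (auto, metis less_Suc_eq not_le)

text \<open>
  The hypothesis \<open>a \<ge> 2\<close> makes the second intervals short enough: their right ends at most double
  the left ends, so no triple starts in a second interval and ends there.
\<close>

theorem T_ge_second_start:
  assumes a: "a \<ge> 2" and r: "r > 0"
  shows "T a a r \<ge> enat (second_start a r (r - 1))"
proof (rule T_ge_of_cover)
  define A where "A j = {start a j..<start a (Suc j)} \<union>
    (if Suc j < r then {second_start a r j..<second_start a r (Suc j)} else {})" for j
  show "{1..<second_start a r (r - 1)} \<subseteq> (\<Union>j<r. A j)"
  proof
    fix m assume m: "m \<in> {1..<second_start a r (r - 1)}"
    show "m \<in> (\<Union>j<r. A j)"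
    proof (cases "m < start a r")
      case True
      then obtain j where "j < r" "start a j \<le> m" "m < start a (Suc j)"
        using ex_step_containing[of "start a" m r] m by auto
      then show ?thesis unfolding A_def by auto
    next
      case False
      then obtain j where "j < r - 1" "second_start a r j \<le> m" "m < second_start a r (Suc j)"
        using ex_step_containing[of "second_start a r" m "r - 1"] m by auto
      then show ?thesis unfolding A_def by (intro UN_I[of j]) auto
    qed
  qed
  show "triple_free a a (A j)" if "j < r" for j
  proof (cases "Suc j < r")
    case True
    let ?s = "start a j" and ?p = "second_start a r j" and ?q = "second_start a r (Suc j)"
    have q: "?q + a * (a * ?s + 1) = 2 * ?p" using second_start_Suc[OF _ True] a by simp
    show ?thesis
    proof (rule triple_free_two_blocks)
      show "A j \<subseteq> {?s..a * ?s + 1} \<union> {?p..<?q}" unfolding A_def using True by auto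
      have "start a (Suc j) < start a (Suc (Suc j))" using a by (intro start_less_Suc) simp
      also have "\<dots> \<le> start a r" using a True by (intro start_mono) simp_all
      also have "\<dots> \<le> ?p" using a that by (intro second_start_ge) simp_all
      finally show "a * ?s + 2 < ?p" by simp
      show "?q + a * (a * ?s + 1) \<le> 2 * ?p" using q by simp
      fix x assume "x \<in> A j" "a * ?s + 1 < x"
      then have "?p \<le> x" unfolding A_def using True by auto
      then have "2 * ?p \<le> a * x" using a by (intro mult_mono) auto
      then show "?q \<le> a * x + 2" using q by linarith
    qed (use a in simp)
  next
    case False
    then show ?thesis unfolding A_def using triple_free_block[of a "start a j"] by simp
  qed
qed

section \<open>A longer coloring with two colors\<close>

text \<open>
  Moving \<open>a + 4\<close> to the first color does no harm: a triple that has it as its middle entry starts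
  with \<open>1\<close> and ends with \<open>a + 8\<close>, and a triple ending with it has middle entry \<open>a + 2\<close>. Both
  numbers have the other color when \<open>a \<ge> 4\<close>. A triple starting with \<open>a + 4\<close> ends at
  \<open>a * a + 4 * a + 2\<close> or later, behind the last interval.
\<close>

lemma triple_free_outer:
  assumes "a \<ge> 4"
  shows "triple_free a a ({1..a + 1} \<union> {a + 4} \<union> {a * a + 2 * a + 2..<a * a + 3 * a + 4})"
    (is "triple_free a a ?A")
  unfolding triple_free_def
proof (intro allI impI notI)
  fix x d :: nat assume "x > 0" "d > 0"
    and x: "x \<in> ?A" and y: "a * x + d \<in> ?A" and z: "a * x + 2 * d \<in> ?A"
  have aa: "4 * a \<le> a * a" using assms by simp
  have "x \<le> a + 1"
  proof (rule ccontr)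
    assume "\<not> x \<le> a + 1"
    then have "a + 4 \<le> x" using x aa assms by auto
    then have "a * (a + 4) \<le> a * x" by simp
    then have "a * a + 4 * a \<le> a * x" by (simp add: algebra_simps)
    then show False using z aa assms by auto
  qed
  then have "a * x \<le> a * (a + 1)" using mult_le_mono2 by blast
  then have ax: "a * x \<le> a * a + a" by (simp add: algebra_simps)
  have y': "a * x + d \<le> a + 4" using y z ax by auto
  have "x = 1"
  proof (rule ccontr)
    assume "x \<noteq> 1"
    then have "a * 2 \<le> a * x" using \<open>x > 0\<close> by (intro mult_le_mono2) simp
    then show False using y' assms \<open>d > 0\<close> by linarith
  qed
  then have "d = 2" using y' z aa assms \<open>d > 0\<close> by auto
  then show False using y \<open>x = 1\<close> aa assms by auto
qed

text \<open>
  The first entries \<open>x \<ge> a + 5\<close> are harmless because \<open>a * (a + 5) + 2\<close> lies behind the coloring;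
  this leaves \<open>a + 3\<close> as the largest relevant one.
\<close>

lemma triple_free_inner:
  assumes "a \<ge> 4"
  shows "triple_free a a
    ({a + 2..a * a + 2 * a + 1} - {a + 4} \<union> {a * a + 3 * a + 4..<a * a + 3 * a + 8})"
    (is "triple_free a a ?A")
proof (rule triple_free_two_blocks)
  let ?q = "a * a + 3 * a + 8"
  show "?A \<subseteq> {a + 2..a * (a + 2) + 1} \<union> {a * a + 3 * a + 4..<?q}"
    by (auto simp: algebra_simps)
  show "?q + a * (a + 3) \<le> 2 * (a * a + 3 * a + 4)" by (simp add: algebra_simps)
  fix x assume "x \<in> ?A" "a + 3 < x"
  then have "a + 5 \<le> x" using assms by auto
  then have "a * (a + 5) \<le> a * x" by simp
  then show "?q \<le> a * x + 2" using assms by (simp add: algebra_simps)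
qed (use assms in \<open>simp_all add: algebra_simps\<close>)

lemma T_two_colors_ge:
  assumes "a \<ge> 4"
  shows "T a a 2 \<ge> enat (a * a + 3 * a + 8)"
proof (rule T_ge_of_cover)
  define A where "A i = (if i = 0
    then {1..a + 1} \<union> {a + 4} \<union> {a * a + 2 * a + 2..<a * a + 3 * a + 4}
    else {a + 2..a * a + 2 * a + 1} - {a + 4} \<union> {a * a + 3 * a + 4..<a * a + 3 * a + 8})"
    for i :: nat
  have "{1..<a * a + 3 * a + 8} \<subseteq> A 0 \<union> A 1" unfolding A_def by auto
  then show "{1..<a * a + 3 * a + 8} \<subseteq> (\<Union>i<2. A i)"
    by (simp add: numeral_2_eq_2 lessThan_Suc Un_commute)
  show "triple_free a a (A i)" for i
    unfolding A_def using triple_free_outer triple_free_inner assms by simp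
qed

section \<open>The bounds for two, three and four colors\<close>

theorem theorem3:
  fixes a :: nat
  assumes "a > 0"
  shows "(a \<ge> 4 \<longrightarrow> T a a 2 \<ge> enat (a ^ 2 + 3 * a + 8)) \<and>
         (a > 1 \<longrightarrow> T a a 3 \<ge> enat (3 * a ^ 3 + 4 * a ^ 2 + 5 * a + 8)) \<and>
         (a > 1 \<longrightarrow> T a a 4 \<ge> enat (7 * a ^ 4 + 12 * a ^ 3 + 6 * a ^ 2 + 9 * a + 16))"
proof (intro conjI impI)
  show "T a a 2 \<ge> enat (a ^ 2 + 3 * a + 8)" if "a \<ge> 4"
    using T_two_colors_ge[OF that] by (simp add: power2_eq_square)
next
  assume "a > 1"
  have step: "second_start a r (Suc j) + a * (a * start a j + 1) = 2 * second_start a r j"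
    if "Suc j < r" for r j
    using second_start_Suc[OF assms that] .
  have "second_start a 3 2 = 3 * a ^ 3 + 4 * a ^ 2 + 5 * a + 8"
    using step[of 0 3] step[of 1 3]
    by (simp del: second_start.simps(2) add: eval_nat_numeral algebra_simps)
  then show "T a a 3 \<ge> enat (3 * a ^ 3 + 4 * a ^ 2 + 5 * a + 8)"
    using T_ge_second_start[of a 3] \<open>a > 1\<close> by simp
  have "second_start a 4 3 = 7 * a ^ 4 + 12 * a ^ 3 + 6 * a ^ 2 + 9 * a + 16"
    using step[of 0 4] step[of 1 4] step[of 2 4]
    by (simp del: second_start.simps(2) add: eval_nat_numeral algebra_simps)
  then show "T a a 4 \<ge> enat (7 * a ^ 4 + 12 * a ^ 3 + 6 * a ^ 2 + 9 * a + 16)"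
    using T_ge_second_start[of a 4] \<open>a > 1\<close> by simp
qed

end
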